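(* Let $I=[0,\infty)$, let $s\in(0,1]$, let $h$ be a positive function, and let $f,g\in SX((h-s)_2,I)$. Let $a,b\in I$ with $a<b$. If $fg\in L_1[a,b]$, then $$\frac{1}{b-a}\int_a^b f^{\frac{x-a}{b-a}}(x)\,g^{\frac{b-x}{b-a}}(x)\,dx \le \frac{f(b)}{(b-a)^2}\int_a^b (x-a)\,h^s\!\left(\frac{x-a}{b-a}\right)dx+\frac{f(a)}{(b-a)^2}\int_a^b (x-a)\,h^s\!\left(\frac{b-x}{b-a}\right)dx$$ $$\qquad+\frac{g(b)}{(b-a)^2}\int_a^b (b-x)\,h^s\!\left(\frac{x-a}{b-a}\right)dx+\frac{g(a)}{(b-a)^2}\int_a^b (b-x)\,h^s\!\left(\frac{b-x}{b-a}\right)dx .$$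
   Context: Notation: $h^s(t)=(h(t))^s$, and $f^{p}(x)=(f(x))^{p}$. Definition of $SX((h-s)_2,I)$: let $h:J\subset\mathbb{R}\to\mathbb{R}$ be a non-negative function, $h\neq 0$, defined at all points of $[0,1]$ (where it is evaluated), and let $s\in(0,1]$. A function $f:I=[0,\infty)\to\mathbb{R}$ is $(h-s)_2$-convex (in the second sense), written $f\in SX((h-s)_2,I)$, if $f$ is non-negative and for all $u,v\in I$ and $t\in[0,1]$, $$f(tu+(1-t)v)\le h^s(t)f(u)+h^s(1-t)f(v).$$ *)

theory Defs
  imports "HOL-Analysis.Analysis"
begin

text \<open>
  The class of (h-s)-convex functions in the second sense on an interval \<open>I\<close>. Functions on
  \<open>I\<close> and on the domain of \<open>h\<close> are modelled as total functions on the reals; only their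
  values on \<open>I\<close> and on \<open>{0..1}\<close>, respectively, matter. The definition is meant for
  \<open>h \<ge> 0\<close> on \<open>{0..1}\<close> and \<open>0 < s \<le> 1\<close>, where \<open>powr\<close> is the ordinary power
  (with \<open>0 powr s = 0\<close>).
\<close>

definition SX2 :: "(real \<Rightarrow> real) \<Rightarrow> real \<Rightarrow> real set \<Rightarrow> (real \<Rightarrow> real) set" where
  "SX2 h s I = {f. (\<forall>x\<in>I. 0 \<le> f x) \<and>
     (\<forall>u\<in>I. \<forall>v\<in>I. \<forall>t\<in>{0..1}.
        f (t * u + (1 - t) * v) \<le> h t powr s * f u + h (1 - t) powr s * f v)}"

end

theory Submission
  imports Defs
begin

text \<open>
  Young's inequality \<open>F powr t * G powr (1 - t) \<le> t * F + (1 - t) * G\<close> and convexity at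
  \<open>x = t b + (1 - t) a\<close>, where \<open>t = (x - a) / (b - a)\<close>, bound the left integrand pointwise by the
  right one, which is integrable and non-negative. The left integrand may fail to be integrable,
  since measurability of \<open>f\<close> and \<open>g\<close> is not assumed; its integral is then \<open>0\<close> by convention and the
  inequality still holds.
\<close>

text \<open>If a factor is zero, the left side vanishes because \<open>0 powr x = 0\<close> for
  every \<open>x\<close>, even \<open>x = 0\<close>. Otherwise this is weighted AM-GM for positive
  reals.\<close>

lemma Youngs_inequality_nonneg:
  fixes a b :: real
  assumes "0 \<le> \<alpha>" "0 \<le> \<beta>" "\<alpha> + \<beta> = 1" "0 \<le> a" "0 \<le> b"
  shows "a powr \<alpha> * b powr \<beta> \<le> \<alpha> * a + \<beta> * b"
proof (cases "a = 0 \<or> b = 0")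
  case True
  then show ?thesis using assms by auto
next
  case False
  then show ?thesis using assms by (intro Youngs_inequality_0) auto
qed

lemma SX2_bound:
  assumes "f \<in> SX2 h s I" "u \<in> I" "v \<in> I" "0 \<le> t" "0 \<le> 1 - t"
  shows "f (t * u + (1 - t) * v) \<le> h t powr s * f u + h (1 - t) powr s * f v"
  using assms by (auto simp: SX2_def)

theorem theorem3:
  fixes f g h :: "real \<Rightarrow> real" and J :: "real set" and s a b :: real
  assumes s: "0 < s" "s \<le> 1"
    and J: "{0..1} \<subseteq> J"
    and h_pos: "\<forall>t\<in>J. 0 < h t"
    and f: "f \<in> SX2 h s {0..}"
    and g: "g \<in> SX2 h s {0..}"
    and ab: "a \<in> {0..}" "b \<in> {0..}" "a < b"
    and fg: "set_integrable lebesgue {a..b} (\<lambda>x. f x * g x)"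
    and int_fb: "set_integrable lebesgue {a..b} (\<lambda>x. (x - a) * h ((x - a) / (b - a)) powr s)"
    and int_fa: "set_integrable lebesgue {a..b} (\<lambda>x. (x - a) * h ((b - x) / (b - a)) powr s)"
    and int_gb: "set_integrable lebesgue {a..b} (\<lambda>x. (b - x) * h ((x - a) / (b - a)) powr s)"
    and int_ga: "set_integrable lebesgue {a..b} (\<lambda>x. (b - x) * h ((b - x) / (b - a)) powr s)"
  shows "1 / (b - a) *
      (LINT x:{a..b}|lebesgue. f x powr ((x - a) / (b - a)) * g x powr ((b - x) / (b - a)))
    \<le> f b / (b - a)\<^sup>2 * (LINT x:{a..b}|lebesgue. (x - a) * h ((x - a) / (b - a)) powr s)
      + f a / (b - a)\<^sup>2 * (LINT x:{a..b}|lebesgue. (x - a) * h ((b - x) / (b - a)) powr s)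
      + g b / (b - a)\<^sup>2 * (LINT x:{a..b}|lebesgue. (b - x) * h ((x - a) / (b - a)) powr s)
      + g a / (b - a)\<^sup>2 * (LINT x:{a..b}|lebesgue. (b - x) * h ((b - x) / (b - a)) powr s)"
proof -
  define p where "p x = (x - a) / (b - a)" for x
  have p1: "1 - p x = (b - x) / (b - a)" for x
    using ab by (simp add: p_def field_simps)
  \<comment> \<open>\<open>W x\<close> is \<open>b - a\<close> times the pointwise bound. Its
    summands are constant multiples of the four integrands on the right, so linearity of the
    integral will split it.\<close>
  define W where "W x = f b * ((x - a) * h ((x - a) / (b - a)) powr s)
      + f a * ((x - a) * h ((b - x) / (b - a)) powr s)
      + g b * ((b - x) * h ((x - a) / (b - a)) powr s)
      + g a * ((b - x) * h ((b - x) / (b - a)) powr s)" for x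
  have nonneg: "0 \<le> f x" "0 \<le> g x" if "0 \<le> x" for x
    using f g that by (auto simp: SX2_def)
  have W_nonneg: "0 \<le> W x" if "x \<in> {a..b}" for x
    using that ab nonneg[of a] nonneg[of b] by (auto simp: W_def)
  have pointwise: "f x powr ((x - a) / (b - a)) * g x powr ((b - x) / (b - a)) \<le> W x / (b - a)"
    if x: "x \<in> {a..b}" for x
  proof -
    have p: "0 \<le> p x" "0 \<le> 1 - p x"
      unfolding p1 unfolding p_def using x ab by auto
    have "p x * (b - a) = x - a"
      using ab by (simp add: p_def)
    then have conv: "p x * b + (1 - p x) * a = x"
      by (simp add: algebra_simps)
    have "f x powr p x * g x powr (1 - p x) \<le> p x * f x + (1 - p x) * g x"
      using p x ab nonneg[of x] by (intro Youngs_inequality_nonneg) auto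
    \<comment> \<open>Convexity of \<open>f\<close> and of \<open>g\<close> at \<open>u = b\<close>,
      \<open>v = a\<close>, \<open>t = p x\<close>, where \<open>conv\<close> identifies the
      argument as \<open>x\<close>; the weights \<open>p x\<close> and \<open>1 - p x\<close> are
      non-negative.\<close>
    also have "\<dots> \<le> p x * (h (p x) powr s * f b + h (1 - p x) powr s * f a)
        + (1 - p x) * (h (p x) powr s * g b + h (1 - p x) powr s * g a)"
      using SX2_bound[OF f, of b a "p x"] SX2_bound[OF g, of b a "p x"] p ab
      unfolding conv by (intro add_mono mult_left_mono) auto
    also have "\<dots> = W x / (b - a)"
      unfolding p1 unfolding p_def W_def by (simp add: add_divide_distrib diff_divide_distrib algebra_simps)
    finally show ?thesis
      unfolding p1 unfolding p_def .
  qed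
  note ints = int_fb int_fa int_gb int_ga
  have W_int: "set_integrable lebesgue {a..b} W"
    unfolding W_def by (intro set_integral_add set_integrable_mult_right ints impI)
  have "(LINT x:{a..b}|lebesgue. f x powr ((x - a) / (b - a)) * g x powr ((b - x) / (b - a)))
      \<le> (LINT x:{a..b}|lebesgue. W x / (b - a))"
    unfolding set_lebesgue_integral_def
  \<comment> \<open>Only the majorant has to be integrable and non-negative here, which
    \<open>W_int\<close> and \<open>W_nonneg\<close> provide.\<close>
  proof (rule integral_mono')
    show "integrable lebesgue (\<lambda>x. indicat_real {a..b} x *\<^sub>R (W x / (b - a)))"
      using W_int unfolding set_integrable_def[symmetric] by (rule set_integrable_divide)
  qed (use pointwise W_nonneg ab in \<open>auto simp: indicator_def\<close>)
  also have "\<dots> = (LINT x:{a..b}|lebesgue. W x) / (b - a)"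
    by simp
  also have "(LINT x:{a..b}|lebesgue. W x)
      = f b * (LINT x:{a..b}|lebesgue. (x - a) * h ((x - a) / (b - a)) powr s)
      + f a * (LINT x:{a..b}|lebesgue. (x - a) * h ((b - x) / (b - a)) powr s)
      + g b * (LINT x:{a..b}|lebesgue. (b - x) * h ((x - a) / (b - a)) powr s)
      + g a * (LINT x:{a..b}|lebesgue. (b - x) * h ((b - x) / (b - a)) powr s)"
    unfolding W_def
    by (simp only: set_integral_add set_integrable_mult_right ints set_integral_mult_right)
  finally show ?thesis
    \<comment> \<open>The bound on the integral carries one factor \<open>1 / (b - a)\<close> from
      the weights; the prefactor of the mean contributes the second, giving the square.\<close>
    using ab divide_right_mono[of _ _ "b - a"]
    by (fastforce simp: add_divide_distrib power2_eq_square)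
qed

end
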